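(* There exist an absolute constant $K>0$ and a deterministic matching mechanism with the following property. For every $n\ge 1$, for every ordinal matching problem instance with $n$ agents and $n$ items, and for every metric $d$ consistent with the instance, the perfect matching $M$ output by the mechanism on that instance satisfies $\mathrm{cost}_d(M)\le K n^2\cdot \mathrm{cost}_d(M_{\mathrm{OPT}})$, where $M_{\mathrm{OPT}}$ is a minimum-cost perfect matching with respect to $d$. That is, there is a deterministic matching mechanism that guarantees distortion $O(n^2)$.
   Context: Agents $A=\{a_1,\dots,a_n\}$ and items $B=\{b_1,\dots,b_n\}$. A metric is a function $d:(A\cup B)\times(A\cup B)\to\mathbb{R}_{\ge 0}$ with $d(x,x)=0$, $d(x,y)=d(y,x)$ and $d(x,y)\le d(x,z)+d(z,y)$ (distinct points are allowed to be at distance $0$). An ordinal matching problem instance consists of $n$ preference lists, one per agent; each list is a permutation of $B$. A metric $d$ is consistent with the instance if, for every agent $a_i$, whenever $b_j$ appears before $b_k$ in the list of $a_i$ we have $d(a_i,b_j)\le d(a_i,b_k)$ (each list is in increasing order of distance, ties broken arbitrarily). A perfect matching is a bijection $M:A\to B$, and $\mathrm{cost}_d(M)=\sum_{i=1}^n d(a_i,M(a_i))$. A deterministic matching mechanism is a function that maps each ordinal matching problem instance (it sees only the preference lists, not $d$) to a perfect matching. The distortion of a matching $M$ with respect to $d$ is $\mathrm{cost}_d(M)/\mathrm{cost}_d(M_{\mathrm{OPT}})$; a mechanism guarantees distortion $D$ if $\mathrm{cost}_d(M)\le D\cdot\mathrm{cost}_d(M_{\mathrm{OPT}})$ for all instances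 and all consistent metrics. *)

theory Defs
  imports Complex_Main
begin

(* Agents and items are numbered 0, ..., n - 1. *)
datatype point = Agent nat | Item nat

definition points :: "nat \<Rightarrow> point set" where
  "points n = Agent ` {..<n} \<union> Item ` {..<n}"

(* Distinct points may be at distance 0, so the metric spaces of the library do not apply. *)
definition is_metric :: "nat \<Rightarrow> (point \<Rightarrow> point \<Rightarrow> real) \<Rightarrow> bool" where
  "is_metric n d \<longleftrightarrow>
     (\<forall>x\<in>points n. \<forall>y\<in>points n. 0 \<le> d x y) \<and>
     (\<forall>x\<in>points n. d x x = 0) \<and>
     (\<forall>x\<in>points n. \<forall>y\<in>points n. d x y = d y x) \<and>
     (\<forall>x\<in>points n. \<forall>y\<in>points n. \<forall>z\<in>points n. d x y \<le> d x z + d z y)"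

(* P ! i is the preference list of agent i, most preferred item first. *)
type_synonym preference_lists = "nat list list"

definition is_instance :: "nat \<Rightarrow> preference_lists \<Rightarrow> bool" where
  "is_instance n P \<longleftrightarrow>
     length P = n \<and> (\<forall>i<n. distinct (P ! i) \<and> set (P ! i) = {..<n})"

definition appears_before :: "'a list \<Rightarrow> 'a \<Rightarrow> 'a \<Rightarrow> bool" where
  "appears_before xs x y \<longleftrightarrow> (\<exists>p q. p < q \<and> q < length xs \<and> xs ! p = x \<and> xs ! q = y)"

definition consistent :: "nat \<Rightarrow> preference_lists \<Rightarrow> (point \<Rightarrow> point \<Rightarrow> real) \<Rightarrow> bool" where
  "consistent n P d \<longleftrightarrow>
     (\<forall>i<n. \<forall>j<n. \<forall>k<n.
        appears_before (P ! i) j k \<longrightarrow> d (Agent i) (Item j) \<le> d (Agent i) (Item k))"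

(* Values outside {..<n} are irrelevant. *)
definition perfect_matching :: "nat \<Rightarrow> (nat \<Rightarrow> nat) \<Rightarrow> bool" where
  "perfect_matching n M \<longleftrightarrow> bij_betw M {..<n} {..<n}"

definition cost :: "nat \<Rightarrow> (point \<Rightarrow> point \<Rightarrow> real) \<Rightarrow> (nat \<Rightarrow> nat) \<Rightarrow> real" where
  "cost n d M = (\<Sum>i<n. d (Agent i) (Item (M i)))"

definition min_cost_matching :: "nat \<Rightarrow> (point \<Rightarrow> point \<Rightarrow> real) \<Rightarrow> (nat \<Rightarrow> nat) \<Rightarrow> bool" where
  "min_cost_matching n d M \<longleftrightarrow>
     perfect_matching n M \<and> (\<forall>M'. perfect_matching n M' \<longrightarrow> cost n d M \<le> cost n d M')"

(* The argument is the preference lists only; the size n is their number. *)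
definition matching_mechanism :: "(preference_lists \<Rightarrow> nat \<Rightarrow> nat) \<Rightarrow> bool" where
  "matching_mechanism f \<longleftrightarrow> (\<forall>n\<ge>1. \<forall>P. is_instance n P \<longrightarrow> perfect_matching n (f P))"

lemma min_cost_matching_exists: "\<exists>M. min_cost_matching n d M"
proof -
  let ?C = "{cost n d M | M. perfect_matching n M}"
  have "?C \<subseteq> (\<lambda>xs. cost n d (\<lambda>i. xs ! i)) ` {xs. set xs \<subseteq> {..<n} \<and> length xs = n}"
  proof
    fix c assume "c \<in> ?C"
    then obtain M where M: "bij_betw M {..<n} {..<n}" "c = cost n d M"
      by (auto simp: perfect_matching_def)
    have "c = cost n d (\<lambda>i. map M [0..<n] ! i)"
      by (simp add: M(2) cost_def)
    moreover have "set (map M [0..<n]) \<subseteq> {..<n}"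
      using bij_betwE[OF M(1)] by auto
    ultimately show "c \<in> (\<lambda>xs. cost n d (\<lambda>i. xs ! i)) ` {xs. set xs \<subseteq> {..<n} \<and> length xs = n}"
      by (intro image_eqI[of _ _ "map M [0..<n]"]) auto
  qed
  then have fin: "finite ?C"
    using finite_lists_length_eq[of "{..<n}" n] by (meson finite_imageI finite_lessThan finite_subset)
  have "perfect_matching n id"
    by (simp add: perfect_matching_def)
  then have "?C \<noteq> {}"
    by blast
  then have "Min ?C \<in> ?C"
    using fin by (intro Min_in)
  moreover have "\<forall>c\<in>?C. Min ?C \<le> c"
    using fin by (blast intro: Min_le)
  ultimately obtain M where "perfect_matching n M" "\<forall>c\<in>?C. cost n d M \<le> c"
    by force
  then show ?thesis
    unfolding min_cost_matching_def by blast
qed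

end

theory Submission
  imports Defs "HOL-Combinatorics.Transposition"
begin

text \<open>
  Random serial dictatorship (agents pick their favourite remaining item in uniformly random order)
  yields a fractional matching \<open>x\<close> of cost at most \<open>n \<cdot> OPT\<close>. It remains to replace \<open>x\<close>, without
  knowing \<open>d\<close>, by a perfect matching \<open>M\<close> at the price of a factor \<open>2 n\<close>.

  View \<open>x\<close> as edge weights of a graph on the \<open>2 n\<close> points and split this graph recursively along
  minimum cuts. If an edge is cut by a minimum cut of value \<open>k\<close>, give it the weight \<open>w = 1 / k\<close>. Each
  of the \<open>2 n - 1\<close> cuts contributes at most 1 to \<open>\<Sum> x w\<close>. Sweeping balls around one endpoint of
  the edge, each of which is a cut of value at least \<open>k\<close>, shows that the length of the edge is at most
  \<open>w\<close> times the cost of \<open>x\<close>. As \<open>x\<close> is an average of matchings, some matching \<open>M\<close> in its support has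
  \<open>w\<close>-weight at most \<open>\<Sum> x w < 2 n\<close>, so its cost is at most \<open>2 n\<close> times that of \<open>x\<close>.
\<close>

section \<open>Minimum cut decomposition of a weighted graph\<close>

text \<open>Ordered pairs are summed, so arcs across \<open>X\<close> count in both directions. In
  the application all weight sits on pairs from an agent to an item, and each edge counts
  once.\<close>

definition cut_weight :: "('v \<Rightarrow> 'v \<Rightarrow> real) \<Rightarrow> 'v set \<Rightarrow> 'v set \<Rightarrow> real" where
  "cut_weight c V X = (\<Sum>p\<in>V. \<Sum>q\<in>V. if p \<in> X \<longleftrightarrow> q \<in> X then 0 else c p q)"

text \<open>This is \<open>is_metric\<close> over an arbitrary vertex set, because the recursion
  along cuts passes to subsets of the points.\<close>

definition pseudometric_on :: "'v set \<Rightarrow> ('v \<Rightarrow> 'v \<Rightarrow> real) \<Rightarrow> bool" where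
  "pseudometric_on V d \<longleftrightarrow>
     (\<forall>x\<in>V. \<forall>y\<in>V. 0 \<le> d x y) \<and>
     (\<forall>x\<in>V. d x x = 0) \<and>
     (\<forall>x\<in>V. \<forall>y\<in>V. d x y = d y x) \<and>
     (\<forall>x\<in>V. \<forall>y\<in>V. \<forall>z\<in>V. d x y \<le> d x z + d z y)"

lemma pseudometric_on_subset: "pseudometric_on V d \<Longrightarrow> X \<subseteq> V \<Longrightarrow> pseudometric_on X d"
  unfolding pseudometric_on_def by blast

text \<open>A discrete coarea argument. For each level s with f y < s <= f z, the points where f < s
  form a cut separating \<open>y\<close> from \<open>z\<close>, hence of weight at least
  \<open>k\<close>; integrated over s, these cut weights are at most the total variation of
  \<open>f\<close>. The induction peels off the slabs between consecutive values of
  \<open>f\<close>, topmost first.\<close>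

lemma cut_weight_mult_le_variation:
  fixes f :: "'v \<Rightarrow> real"
  assumes "finite V" and c: "\<And>p q. 0 \<le> c p q" and "z \<in> V" "y \<in> V"
    and "0 \<le> k" and k: "\<And>X. X \<subseteq> V \<Longrightarrow> y \<in> X \<Longrightarrow> z \<notin> X \<Longrightarrow> k \<le> cut_weight c V X"
  shows "k * (f z - f y) \<le> (\<Sum>p\<in>V. \<Sum>q\<in>V. c p q * \<bar>f p - f q\<bar>)"
proof (induction "card {p\<in>V. f p < f z}" arbitrary: f rule: less_induct)
  case less
  show ?case
  proof (cases "f y < f z")
    case False
    then have "k * (f z - f y) \<le> 0"
      using \<open>0 \<le> k\<close> by (simp add: mult_nonneg_nonpos)
    also have "0 \<le> (\<Sum>p\<in>V. \<Sum>q\<in>V. c p q * \<bar>f p - f q\<bar>)"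
      using c by (intro sum_nonneg mult_nonneg_nonneg) auto
    finally show ?thesis .
  next
    case True
    define X where "X = {p\<in>V. f p < f z}"
    define u where "u = Max (f ` X)"
    \<comment> \<open>For every level in (u, f z] the sublevel set is the same set \<open>X\<close>;
      truncation at \<open>u\<close> cuts off this slab.\<close>
    define g where "g p = min (f p) u" for p
    have "finite X" "y \<in> X"
      using assms True by (auto simp: X_def)
    then have "u \<in> f ` X" and u_ge: "\<And>p. p \<in> X \<Longrightarrow> f p \<le> u"
      unfolding u_def by (auto intro!: Max_in)
    then obtain r where r: "r \<in> X" "f r = u"
      by auto
    have "u < f z"
      using r by (auto simp: X_def)
    \<comment> \<open>The inclusion is strict because \<open>r\<close> lies in \<open>X\<close> but
      attains \<open>u\<close>, which is now the value of \<open>g\<close> at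
      \<open>z\<close>.\<close>
    have "{p\<in>V. g p < g z} \<subset> X"
      using \<open>u < f z\<close> r by (auto simp: X_def g_def min_def split: if_splits)
    then have IH: "k * (g z - g y) \<le> (\<Sum>p\<in>V. \<Sum>q\<in>V. c p q * \<bar>g p - g q\<bar>)"
      using less \<open>finite X\<close> unfolding X_def by (simp add: psubset_card_mono)
    have "g z = u" "g y = f y"
      using \<open>u < f z\<close> u_ge[OF \<open>y \<in> X\<close>] by (auto simp: g_def)
    have "k \<le> cut_weight c V X"
      using \<open>y \<in> X\<close> by (intro k) (auto simp: X_def)
    then have "(f z - u) * k \<le> (f z - u) * cut_weight c V X"
      using \<open>u < f z\<close> by simp
    then have "k * (f z - f y) \<le> (\<Sum>p\<in>V. \<Sum>q\<in>V. c p q * \<bar>g p - g q\<bar>) + (f z - u) * cut_weight c V X"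
      using IH \<open>g z = u\<close> \<open>g y = f y\<close> by (simp add: algebra_simps)
    also have "\<dots> = (\<Sum>p\<in>V. \<Sum>q\<in>V.
        c p q * (\<bar>g p - g q\<bar> + (if p \<in> X \<longleftrightarrow> q \<in> X then 0 else f z - u)))"
      unfolding cut_weight_def sum_distrib_left sum.distrib[symmetric]
      by (intro sum.cong refl) (auto simp: algebra_simps)
    \<comment> \<open>The comparison is termwise. A pair crossing \<open>X\<close> has one value at
      most \<open>u\<close> and the other at least \<open>f z\<close>, so truncation shrinks its
      difference by at least \<open>f z - u\<close>; other differences do not grow.\<close>
    also have "\<dots> \<le> (\<Sum>p\<in>V. \<Sum>q\<in>V. c p q * \<bar>f p - f q\<bar>)"
    proof (intro sum_mono mult_left_mono c)
      fix p q assume "p \<in> V" "q \<in> V"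
      then show "\<bar>g p - g q\<bar> + (if p \<in> X \<longleftrightarrow> q \<in> X then 0 else f z - u) \<le> \<bar>f p - f q\<bar>"
        using u_ge[of p] u_ge[of q] \<open>u < f z\<close> by (auto simp: X_def g_def min_def)
    qed
    finally show ?thesis .
  qed
qed

text \<open>The potential is the distance from \<open>y\<close>: its sublevel sets are balls around
  \<open>y\<close>, and the triangle inequality makes it 1-Lipschitz.\<close>

lemma min_cut_mult_dist_le:
  assumes "finite V" and c: "\<And>p q. 0 \<le> c p q" and "y \<in> V" "z \<in> V"
    and "0 \<le> k" and k: "\<And>X. X \<subseteq> V \<Longrightarrow> y \<in> X \<Longrightarrow> z \<notin> X \<Longrightarrow> k \<le> cut_weight c V X"
    and d: "pseudometric_on V d"
  shows "k * d y z \<le> (\<Sum>p\<in>V. \<Sum>q\<in>V. c p q * d p q)"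
proof -
  have "k * (d y z - d y y) \<le> (\<Sum>p\<in>V. \<Sum>q\<in>V. c p q * \<bar>d y p - d y q\<bar>)"
    using assms by (intro cut_weight_mult_le_variation) auto
  also have "\<dots> \<le> (\<Sum>p\<in>V. \<Sum>q\<in>V. c p q * d p q)"
  proof (intro sum_mono mult_left_mono c)
    fix p q assume "p \<in> V" "q \<in> V"
    then have "d y p \<le> d y q + d q p" "d y q \<le> d y p + d p q" "d q p = d p q"
      using d \<open>y \<in> V\<close> unfolding pseudometric_on_def by blast+
    then show "\<bar>d y p - d y q\<bar> \<le> d p q"
      by linarith
  qed
  finally show ?thesis
    using d \<open>y \<in> V\<close> by (simp add: pseudometric_on_def)
qed

text \<open>The point is the order of quantifiers: \<open>w\<close> is built from \<open>c\<close>
  alone and then serves all pseudometrics at once. The budget \<open>card V - 1\<close> is the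
  number of cuts that reduce \<open>V\<close> to single vertices, one unit for each. Only arcs of
  positive weight are bounded, as different components may be arbitrarily far apart.\<close>

lemma min_cut_decomposition:
  fixes c :: "'v \<Rightarrow> 'v \<Rightarrow> real"
  assumes "finite V" "V \<noteq> {}" and c: "\<And>p q. 0 \<le> c p q"
  shows "\<exists>w. (\<forall>p q. 0 \<le> w p q) \<and>
    (\<Sum>p\<in>V. \<Sum>q\<in>V. c p q * w p q) \<le> real (card V) - 1 \<and>
    (\<forall>d. pseudometric_on V d \<longrightarrow>
      (\<forall>y\<in>V. \<forall>z\<in>V. 0 < c y z \<longrightarrow> d y z \<le> w y z * (\<Sum>p\<in>V. \<Sum>q\<in>V. c p q * d p q)))"
  using assms(1,2)
proof (induction "card V" arbitrary: V rule: less_induct)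
  case less
  show ?case
  proof (cases "\<exists>v. V = {v}")
    case True
    then show ?thesis
      by (intro exI[of _ "\<lambda>_ _. 0"]) (auto simp: pseudometric_on_def)
  next
    case False
    let ?cuts = "{X. X \<subseteq> V \<and> X \<noteq> {} \<and> X \<noteq> V}"
    have "?cuts \<noteq> {}"
      using False less.prems by blast
    moreover have "finite ?cuts"
      using less.prems by simp
    \<comment> \<open>A global minimum cut is taken, so that its weight bounds from below all cuts
      separating any pair that crosses \<open>X\<close>, in either order.\<close>
    ultimately obtain X where "is_arg_min (cut_weight c V) (\<lambda>X. X \<in> ?cuts) X"
      using ex_is_arg_min_if_finite by blast
    then have X: "X \<subseteq> V" "X \<noteq> {}" "X \<noteq> V"
      and min: "\<And>Y. Y \<in> ?cuts \<Longrightarrow> cut_weight c V X \<le> cut_weight c V Y"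
      by (auto simp: is_arg_min_linorder)
    define Y where "Y = V - X"
    have fin: "finite X" "finite Y" and Y: "Y \<subseteq> V" "Y \<noteq> {}" "Y \<noteq> V" and V: "V = X \<union> Y" "X \<inter> Y = {}"
      using X less.prems by (auto simp: Y_def intro: finite_subset)
    have "card X < card V" "card Y < card V"
      using X Y less.prems by (auto intro!: psubset_card_mono)
    note IH = less.hyps[OF this(1) fin(1) X(2)] less.hyps[OF this(2) fin(2) Y(2)]
    obtain w1 where w1: "\<And>p q. 0 \<le> w1 p q"
      "(\<Sum>p\<in>X. \<Sum>q\<in>X. c p q * w1 p q) \<le> real (card X) - 1"
      "\<And>d y z. pseudometric_on X d \<Longrightarrow> y \<in> X \<Longrightarrow> z \<in> X \<Longrightarrow> 0 < c y z \<Longrightarrow>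
        d y z \<le> w1 y z * (\<Sum>p\<in>X. \<Sum>q\<in>X. c p q * d p q)"
      using IH(1) by blast
    obtain w2 where w2: "\<And>p q. 0 \<le> w2 p q"
      "(\<Sum>p\<in>Y. \<Sum>q\<in>Y. c p q * w2 p q) \<le> real (card Y) - 1"
      "\<And>d y z. pseudometric_on Y d \<Longrightarrow> y \<in> Y \<Longrightarrow> z \<in> Y \<Longrightarrow> 0 < c y z \<Longrightarrow>
        d y z \<le> w2 y z * (\<Sum>p\<in>Y. \<Sum>q\<in>Y. c p q * d p q)"
      using IH(2) by blast
    define k where "k = cut_weight c V X"
    have k_split: "k = (\<Sum>p\<in>X. \<Sum>q\<in>Y. c p q) + (\<Sum>p\<in>Y. \<Sum>q\<in>X. c p q)"
    proof -
      let ?h = "\<lambda>p q. if p \<in> X \<longleftrightarrow> q \<in> X then 0 else c p q"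
      have "(\<Sum>q\<in>V. ?h p q) = (\<Sum>q\<in>X. ?h p q) + (\<Sum>q\<in>Y. ?h p q)" for p
        using fin V by (simp only: sum.union_disjoint)
      moreover have "(\<Sum>q\<in>X. ?h p q) = (if p \<in> X then 0 else \<Sum>q\<in>X. c p q)" for p
        by (auto intro: sum.neutral)
      moreover have "(\<Sum>q\<in>Y. ?h p q) = (if p \<in> X then \<Sum>q\<in>Y. c p q else 0)" for p
        by (auto simp: Y_def intro!: sum.cong sum.neutral)
      ultimately have row: "(\<Sum>q\<in>V. ?h p q) = (if p \<in> X then \<Sum>q\<in>Y. c p q else \<Sum>q\<in>X. c p q)" for p
        by simp
      have "k = (\<Sum>p\<in>X. \<Sum>q\<in>V. ?h p q) + (\<Sum>p\<in>Y. \<Sum>q\<in>V. ?h p q)"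
        unfolding k_def cut_weight_def
        using fin V sum.union_disjoint[of X Y "\<lambda>p. \<Sum>q\<in>V. ?h p q"] by simp
      then show ?thesis
        unfolding row by (simp add: Y_def)
    qed
    have "0 \<le> k"
      using c by (simp add: k_split sum_nonneg)
    \<comment> \<open>If \<open>k = 0\<close>, then \<open>1 / k = 0\<close> is harmless because no edge of positive weight crosses the cut.\<close>
    define w where "w p q =
      (if p \<in> X \<and> q \<in> X then w1 p q else if p \<notin> X \<and> q \<notin> X then w2 p q else 1 / k)" for p q
    have sum_split: "(\<Sum>p\<in>V. \<Sum>q\<in>V. h p q) =
        (\<Sum>p\<in>X. \<Sum>q\<in>X. h p q) + (\<Sum>p\<in>Y. \<Sum>q\<in>Y. h p q) +
        ((\<Sum>p\<in>X. \<Sum>q\<in>Y. h p q) + (\<Sum>p\<in>Y. \<Sum>q\<in>X. h p q))" for h :: "'v \<Rightarrow> 'v \<Rightarrow> real"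
      using fin V by (simp add: sum.union_disjoint sum.distrib)
    have "\<forall>p q. 0 \<le> w p q"
      using w1(1) w2(1) \<open>0 \<le> k\<close> by (auto simp: w_def)
    moreover have "(\<Sum>p\<in>V. \<Sum>q\<in>V. c p q * w p q) \<le> real (card V) - 1"
    proof -
      have "(\<Sum>p\<in>X. \<Sum>q\<in>X. c p q * w p q) = (\<Sum>p\<in>X. \<Sum>q\<in>X. c p q * w1 p q)"
        by (intro sum.cong refl) (auto simp: w_def)
      moreover have "(\<Sum>p\<in>Y. \<Sum>q\<in>Y. c p q * w p q) = (\<Sum>p\<in>Y. \<Sum>q\<in>Y. c p q * w2 p q)"
        by (intro sum.cong refl) (auto simp: w_def Y_def)
      \<comment> \<open>The crossing arcs have total weight \<open>k\<close> and price
        \<open>1 / k\<close>, so this cut uses at most one unit; with \<open>card X - 1\<close> and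
        \<open>card Y - 1\<close> from the two sides the budget is met.\<close>
      moreover have "(\<Sum>p\<in>X. \<Sum>q\<in>Y. c p q * w p q) + (\<Sum>p\<in>Y. \<Sum>q\<in>X. c p q * w p q) = k / k"
      proof -
        have "(\<Sum>p\<in>X. \<Sum>q\<in>Y. c p q * w p q) = (\<Sum>p\<in>X. \<Sum>q\<in>Y. c p q) / k"
          unfolding sum_divide_distrib by (intro sum.cong refl) (auto simp: w_def Y_def)
        moreover have "(\<Sum>p\<in>Y. \<Sum>q\<in>X. c p q * w p q) = (\<Sum>p\<in>Y. \<Sum>q\<in>X. c p q) / k"
          unfolding sum_divide_distrib by (intro sum.cong refl) (auto simp: w_def Y_def)
        ultimately show ?thesis
          by (simp only: k_split add_divide_distrib)
      qed
      moreover have "k / k \<le> 1"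
        by simp
      moreover have "card V = card X + card Y"
        using fin V by (simp add: card_Un_disjoint)
      ultimately show ?thesis
        using w1(2) w2(2) unfolding sum_split by simp
    qed
    moreover have "d y z \<le> w y z * (\<Sum>p\<in>V. \<Sum>q\<in>V. c p q * d p q)"
      if d: "pseudometric_on V d" and yz: "y \<in> V" "z \<in> V" "0 < c y z" for d y z
    proof -
      have nonneg: "0 \<le> c p q * d p q" if "p \<in> V" "q \<in> V" for p q
        using that c d by (simp add: pseudometric_on_def)
      have pos: "0 \<le> (\<Sum>p\<in>A. \<Sum>q\<in>B. c p q * d p q)" if "A \<subseteq> V" "B \<subseteq> V" for A B
        using that nonneg by (intro sum_nonneg) blast
      have le: "(\<Sum>p\<in>X. \<Sum>q\<in>X. c p q * d p q) \<le> (\<Sum>p\<in>V. \<Sum>q\<in>V. c p q * d p q)"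
        "(\<Sum>p\<in>Y. \<Sum>q\<in>Y. c p q * d p q) \<le> (\<Sum>p\<in>V. \<Sum>q\<in>V. c p q * d p q)"
        using pos[of X X] pos[of Y Y] pos[of X Y] pos[of Y X] X Y unfolding sum_split by auto
      consider "y \<in> X" "z \<in> X" | "y \<in> Y" "z \<in> Y" | "(y \<in> X) \<noteq> (z \<in> X)"
        using yz V by auto
      then show ?thesis
      proof cases
        case 1
        then have "d y z \<le> w1 y z * (\<Sum>p\<in>X. \<Sum>q\<in>X. c p q * d p q)"
          using w1(3) d X yz pseudometric_on_subset by blast
        also have "\<dots> \<le> w1 y z * (\<Sum>p\<in>V. \<Sum>q\<in>V. c p q * d p q)"
          using le w1(1) by (intro mult_left_mono)
        finally show ?thesis
          using 1 by (simp add: w_def)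
      next
        case 2
        then have "d y z \<le> w2 y z * (\<Sum>p\<in>Y. \<Sum>q\<in>Y. c p q * d p q)"
          using w2(3) d Y yz pseudometric_on_subset by blast
        also have "\<dots> \<le> w2 y z * (\<Sum>p\<in>V. \<Sum>q\<in>V. c p q * d p q)"
          using le w2(1) by (intro mult_left_mono)
        finally show ?thesis
          using 2 by (simp add: w_def Y_def)
      next
        case 3
        have nonneg_if: "0 \<le> (if p \<in> X \<longleftrightarrow> q \<in> X then 0 else c p q)" for p q
          using c by simp
        \<comment> \<open>The arc from \<open>y\<close> to \<open>z\<close> is itself a summand of
          \<open>k\<close>, so \<open>k\<close> is positive and \<open>1 / k\<close> is a genuine
          reciprocal.\<close>
        have "c y z = (if y \<in> X \<longleftrightarrow> z \<in> X then 0 else c y z)"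
          using 3 by simp
        also have "\<dots> \<le> (\<Sum>q\<in>V. if y \<in> X \<longleftrightarrow> q \<in> X then 0 else c y q)"
          using yz(2) less.prems(1) nonneg_if
          by (intro member_le_sum[where f = "\<lambda>q. if y \<in> X \<longleftrightarrow> q \<in> X then 0 else c y q"])
        also have "\<dots> \<le> k"
          unfolding k_def cut_weight_def using yz(1) less.prems(1)
          by (intro member_le_sum[where f = "\<lambda>p. \<Sum>q\<in>V. if p \<in> X \<longleftrightarrow> q \<in> X then 0 else c p q"])
            (simp_all only: sum_nonneg nonneg_if)
        finally have "0 < k"
          using yz by simp
        have "k \<le> cut_weight c V Z" if "Z \<subseteq> V" "y \<in> Z" "z \<notin> Z" for Z
          unfolding k_def using that yz by (intro min) auto
        then have "k * d y z \<le> (\<Sum>p\<in>V. \<Sum>q\<in>V. c p q * d p q)"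
          using less.prems c yz d \<open>0 \<le> k\<close> by (intro min_cut_mult_dist_le) auto
        moreover have "w y z = 1 / k"
          using 3 by (auto simp: w_def)
        ultimately show ?thesis
          using \<open>0 < k\<close> by (simp add: pos_le_divide_eq mult.commute)
      qed
    qed
    ultimately show ?thesis
      by blast
  qed
qed

section \<open>Random serial dictatorship\<close>

text \<open>The second condition is the triangle inequality as far as it involves only distances between
  agents and items; \<open>R a b b'\<close> says that agent \<open>a\<close> prefers item \<open>b\<close> to item \<open>b'\<close>.\<close>

definition consistent_on ::
  "'a set \<Rightarrow> 'b set \<Rightarrow> ('a \<Rightarrow> 'b \<Rightarrow> 'b \<Rightarrow> bool) \<Rightarrow> ('a \<Rightarrow> 'b \<Rightarrow> real) \<Rightarrow> bool" where
  "consistent_on A B R d \<longleftrightarrow>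
     (\<forall>a\<in>A. \<forall>b\<in>B. 0 \<le> d a b) \<and>
     (\<forall>a\<in>A. \<forall>a'\<in>A. \<forall>b\<in>B. \<forall>b'\<in>B. d a b \<le> d a b' + d a' b' + d a' b) \<and>
     (\<forall>a\<in>A. \<forall>b\<in>B. \<forall>b'\<in>B. R a b b' \<longrightarrow> d a b \<le> d a b')"

lemma consistent_on_subset:
  "consistent_on A B R d \<Longrightarrow> A' \<subseteq> A \<Longrightarrow> B' \<subseteq> B \<Longrightarrow> consistent_on A' B' R d"
  unfolding consistent_on_def by blast

text \<open>After \<open>a\<close> takes \<open>t\<close>, the agent that \<open>N\<close> matched
  to \<open>t\<close> receives \<open>N a\<close> instead. Its detour through \<open>t\<close> and
  \<open>a\<close> adds at most \<open>2 * d a (N a)\<close>, while the term of \<open>a\<close>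
  leaves the sum, so the net increase is at most one \<open>d a (N a)\<close>.\<close>

lemma bij_betw_after_first_pick:
  assumes "finite A" and N: "bij_betw N A B" and "a \<in> A" "t \<in> B"
    and d: "consistent_on A B R d" and t: "d a t \<le> d a (N a)"
  shows "\<exists>N'. bij_betw N' (A - {a}) (B - {t}) \<and>
    (\<Sum>a'\<in>A - {a}. d a' (N' a')) \<le> (\<Sum>a'\<in>A. d a' (N a')) + d a (N a)"
proof -
  have "N a \<in> B"
    using N \<open>a \<in> A\<close> by (rule bij_betw_apply)
  define N' where "N' = transpose (N a) t \<circ> N"
  have "bij_betw (transpose (N a) t) B B"
    using \<open>N a \<in> B\<close> \<open>t \<in> B\<close> by (simp add: bij_betw_transpose_iff)
  then have "bij_betw N' A B"
    unfolding N'_def using N bij_betw_trans by blast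
  moreover have "N' a = t"
    by (simp add: N'_def)
  ultimately have bij: "bij_betw N' (A - {a}) (B - {t})"
    using \<open>a \<in> A\<close> by (metis bij_betw_DiffI bij_betw_singletonI empty_subsetI insert_subset \<open>t \<in> B\<close>)
  have d_nonneg: "0 \<le> d a (N a)"
    using d \<open>a \<in> A\<close> \<open>N a \<in> B\<close> by (simp add: consistent_on_def)
  obtain a1 where a1: "a1 \<in> A" "N a1 = t"
    using N \<open>t \<in> B\<close> by (metis bij_betw_iff_bijections)
  have other: "N' a' = N a'" if "a' \<in> A" "a' \<noteq> a" "a' \<noteq> a1" for a'
    using that a1 \<open>a \<in> A\<close> inj_onD[OF bij_betw_imp_inj_on[OF N], of a' a]
      inj_onD[OF bij_betw_imp_inj_on[OF N], of a' a1]
    by (auto simp: N'_def transpose_def)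
  have "(\<Sum>a'\<in>A - {a}. d a' (N' a')) \<le> (\<Sum>a'\<in>A. d a' (N a')) + d a (N a)"
  proof (cases "a1 = a")
    case True
    then have "(\<Sum>a'\<in>A - {a}. d a' (N' a')) = (\<Sum>a'\<in>A - {a}. d a' (N a'))"
      using other by (intro sum.cong) auto
    then show ?thesis
      using \<open>finite A\<close> \<open>a \<in> A\<close> d_nonneg by (simp add: sum.remove[of A a])
  next
    case False
    have sum: "sum h A = h a + h a1 + sum h (A - {a} - {a1})" "sum h (A - {a}) = h a1 + sum h (A - {a} - {a1})"
      for h :: "'a \<Rightarrow> real"
      using \<open>finite A\<close> \<open>a \<in> A\<close> a1 False by (auto simp: sum.remove[of A a] sum.remove[of "A - {a}" a1])
    have "(\<Sum>a'\<in>A - {a} - {a1}. d a' (N' a')) = (\<Sum>a'\<in>A - {a} - {a1}. d a' (N a'))"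
      using other by (intro sum.cong) auto
    moreover have "d a1 (N' a1) \<le> d a1 (N a1) + 2 * d a (N a)"
    proof -
      have "d a1 (N a) \<le> d a1 t + d a t + d a (N a)"
        using d a1 \<open>a \<in> A\<close> \<open>t \<in> B\<close> \<open>N a \<in> B\<close> unfolding consistent_on_def by blast
      then show ?thesis
        using t a1 by (simp add: N'_def)
    qed
    ultimately show ?thesis
      unfolding sum by simp
  qed
  then show ?thesis
    using bij by blast
qed

text \<open>The second condition says that \<open>x\<close> dominates a convex combination of perfect matchings, without
  committing to the combination.\<close>

definition low_distortion_fractional_matching ::
  "'a set \<Rightarrow> 'b set \<Rightarrow> ('a \<Rightarrow> 'b \<Rightarrow> 'b \<Rightarrow> bool) \<Rightarrow> ('a \<Rightarrow> 'b \<Rightarrow> real) \<Rightarrow> bool" where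
  "low_distortion_fractional_matching A B R x \<longleftrightarrow>
    (\<forall>a b. 0 \<le> x a b) \<and>
    (\<forall>w. \<exists>M. bij_betw M A B \<and> (\<forall>a\<in>A. 0 < x a (M a)) \<and>
      (\<Sum>a\<in>A. w a (M a)) \<le> (\<Sum>a\<in>A. \<Sum>b\<in>B. x a b * w a b)) \<and>
    (\<forall>d N. consistent_on A B R d \<longrightarrow> bij_betw N A B \<longrightarrow>
      (\<Sum>a\<in>A. \<Sum>b\<in>B. x a b * d a b) \<le> real (card A) * (\<Sum>a\<in>A. d a (N a)))"

lemma low_distortion_fractional_matchingD:
  assumes "low_distortion_fractional_matching A B R x"
  shows "0 \<le> x a b"
    and "\<exists>M. bij_betw M A B \<and> (\<forall>a\<in>A. 0 < x a (M a)) \<and>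
      (\<Sum>a\<in>A. w a (M a)) \<le> (\<Sum>a\<in>A. \<Sum>b\<in>B. x a b * w a b)"
    and "consistent_on A B R d \<Longrightarrow> bij_betw N A B \<Longrightarrow>
      (\<Sum>a\<in>A. \<Sum>b\<in>B. x a b * d a b) \<le> real (card A) * (\<Sum>a\<in>A. d a (N a))"
  using assms unfolding low_distortion_fractional_matching_def by blast+

text \<open>Induction on the number of agents: a uniformly random first agent takes its favourite
  item, and the induction hypothesis handles what remains. The preferences enter only through
  favourites, and \<open>x\<close> is fixed before \<open>w\<close>, \<open>d\<close> and
  \<open>N\<close>.\<close>

lemma random_serial_dictatorship:
  fixes A :: "'a set" and B :: "'b set" and R :: "'a \<Rightarrow> 'b \<Rightarrow> 'b \<Rightarrow> bool"
  assumes "finite A" "finite B" "card A = card B"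
    and "\<And>a B'. a \<in> A \<Longrightarrow> B' \<subseteq> B \<Longrightarrow> B' \<noteq> {} \<Longrightarrow> \<exists>t\<in>B'. \<forall>b\<in>B'. b = t \<or> R a t b"
  shows "\<exists>x. low_distortion_fractional_matching A B R x"
  using assms
proof (induction "card A" arbitrary: A B)
  case 0
  then have "A = {}" "B = {}"
    by auto
  then show ?case
    by (intro exI[of _ "\<lambda>_ _. 0"]) (auto simp: low_distortion_fractional_matching_def bij_betw_def)
next
  case (Suc m)
  let ?m = "real (Suc m)"
  have "B \<noteq> {}"
    using Suc.hyps(2) Suc.prems(3) by auto
  then have "\<forall>a\<in>A. \<exists>t\<in>B. \<forall>b\<in>B. b = t \<or> R a t b"
    using Suc.prems(4) by blast
  then obtain t where t: "\<And>a. a \<in> A \<Longrightarrow> t a \<in> B" "\<And>a b. a \<in> A \<Longrightarrow> b \<in> B \<Longrightarrow> b = t a \<or> R a (t a) b"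
    by metis
  have "\<exists>x. low_distortion_fractional_matching (A - {a}) (B - {t a}) R x" if a: "a \<in> A" for a
  proof (rule Suc.hyps(1))
    show "m = card (A - {a})" "card (A - {a}) = card (B - {t a})"
      using Suc.hyps(2) Suc.prems(1-3) a t(1)[OF a] by (auto simp: card_Diff_singleton)
    show "\<exists>t\<in>B'. \<forall>b\<in>B'. b = t \<or> R a' t b" if "a' \<in> A - {a}" "B' \<subseteq> B - {t a}" "B' \<noteq> {}" for a' B'
      using that by (intro Suc.prems(4)) auto
  qed (use Suc.prems in auto)
  then obtain x0 where
    x0: "\<And>a. a \<in> A \<Longrightarrow> low_distortion_fractional_matching (A - {a}) (B - {t a}) R (x0 a)"
    by metis
  note x0_nonneg = low_distortion_fractional_matchingD(1)[OF x0]
  define rest where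
    "rest a h = (\<Sum>a'\<in>A - {a}. \<Sum>b\<in>B - {t a}. x0 a a' b * h a' b)" for a and h :: "'a \<Rightarrow> 'b \<Rightarrow> real"
  \<comment> \<open>\<open>y a\<close> is the fractional matching conditioned on \<open>a\<close>
    picking first: \<open>a\<close> receives all of \<open>t a\<close>, and the others follow
    \<open>x0 a\<close>. The average of these over \<open>a\<close> is \<open>x\<close>.\<close>
  define y :: "'a \<Rightarrow> 'a \<Rightarrow> 'b \<Rightarrow> real" where
    "y a a' b = (if a' = a then of_bool (b = t a) else if b = t a then 0 else x0 a a' b)" for a a' b
  define x where "x a' b = (\<Sum>a\<in>A. y a a' b) / ?m" for a' b
  have y_nonneg: "0 \<le> y a a' b" if "a \<in> A" for a a' b
    using that x0_nonneg by (simp add: y_def)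
  have x_nonneg: "0 \<le> x a b" for a b
    using y_nonneg by (simp add: x_def sum_nonneg)
  have y_sum: "(\<Sum>a'\<in>A. \<Sum>b\<in>B. y a a' b * h a' b) = h a (t a) + rest a h" if a: "a \<in> A" for a h
  proof -
    have "(\<Sum>a'\<in>A. \<Sum>b\<in>B. y a a' b * h a' b) =
        (\<Sum>b\<in>B. y a a b * h a b) + (\<Sum>a'\<in>A - {a}. \<Sum>b\<in>B. y a a' b * h a' b)"
      using Suc.prems(1) a by (rule sum.remove)
    moreover have "(\<Sum>b\<in>B. y a a b * h a b) = (\<Sum>b\<in>B. if b = t a then h a b else 0)"
      by (intro sum.cong) (auto simp: y_def)
    moreover have "\<dots> = h a (t a)"
      using Suc.prems(2) t(1)[OF a] by simp
    moreover have "(\<Sum>b\<in>B. y a a' b * h a' b) = (\<Sum>b\<in>B - {t a}. x0 a a' b * h a' b)"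
      if "a' \<in> A - {a}" for a'
      using that Suc.prems(2) t(1)[OF a] by (simp add: sum.remove[of B "t a"] y_def)
    ultimately show ?thesis
      by (simp add: rest_def)
  qed
  \<comment> \<open>This linearity is used twice: with \<open>h = w\<close> to find a matching of
    small weight, and with \<open>h = d\<close> to bound the cost.\<close>
  have x_sum: "(\<Sum>a'\<in>A. \<Sum>b\<in>B. x a' b * h a' b) = (\<Sum>a\<in>A. h a (t a) + rest a h) / ?m" for h
  proof -
    have "(\<Sum>a'\<in>A. \<Sum>b\<in>B. x a' b * h a' b) = (\<Sum>a'\<in>A. \<Sum>b\<in>B. \<Sum>a\<in>A. y a a' b * h a' b) / ?m"
      by (simp add: x_def sum_distrib_right sum_divide_distrib)
    also have "(\<Sum>a'\<in>A. \<Sum>b\<in>B. \<Sum>a\<in>A. y a a' b * h a' b) = (\<Sum>a'\<in>A. \<Sum>a\<in>A. \<Sum>b\<in>B. y a a' b * h a' b)"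
      by (intro sum.cong refl sum.swap)
    also have "\<dots> = (\<Sum>a\<in>A. \<Sum>a'\<in>A. \<Sum>b\<in>B. y a a' b * h a' b)"
      by (rule sum.swap)
    also have "\<dots> = (\<Sum>a\<in>A. h a (t a) + rest a h)"
      by (intro sum.cong refl y_sum)
    finally show ?thesis .
  qed
  \<comment> \<open>The support of each \<open>y a\<close> survives averaging, so a matching found
    in one branch lies in the support of \<open>x\<close>.\<close>
  have x_pos: "0 < x a' b" if "a \<in> A" "0 < y a a' b" for a a' b
  proof -
    have "y a a' b \<le> (\<Sum>a\<in>A. y a a' b)"
      using Suc.prems(1) that y_nonneg by (intro member_le_sum[where f = "\<lambda>a. y a a' b"]) auto
    then show ?thesis
      using that by (simp add: x_def)
  qed
  have "\<exists>M. bij_betw M A B \<and> (\<forall>a\<in>A. 0 < x a (M a)) \<and>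
    (\<Sum>a\<in>A. w a (M a)) \<le> (\<Sum>a\<in>A. \<Sum>b\<in>B. x a b * w a b)" for w :: "'a \<Rightarrow> 'b \<Rightarrow> real"
  proof -
    let ?avg = "\<Sum>a\<in>A. \<Sum>b\<in>B. x a b * w a b"
    \<comment> \<open>Derandomization by averaging: some first agent does no worse than the mean,
      and the induction hypothesis completes its pick to a matching.\<close>
    have "\<exists>a\<in>A. w a (t a) + rest a w \<le> ?avg"
    proof (rule ccontr)
      assume "\<not> ?thesis"
      then have "(\<Sum>a\<in>A. ?avg) < (\<Sum>a\<in>A. w a (t a) + rest a w)"
        using Suc.prems(1) Suc.hyps(2) by (intro sum_strict_mono) auto
      moreover have "(\<Sum>a\<in>A. w a (t a) + rest a w) = (\<Sum>a\<in>A. ?avg)"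
        unfolding x_sum using Suc.hyps(2)[symmetric] by simp
      ultimately show False
        by simp
    qed
    then obtain a where a: "a \<in> A" "w a (t a) + rest a w \<le> ?avg"
      by blast
    obtain M where M: "bij_betw M (A - {a}) (B - {t a})" "\<forall>a'\<in>A - {a}. 0 < x0 a a' (M a')"
      "(\<Sum>a'\<in>A - {a}. w a' (M a')) \<le> rest a w"
      using low_distortion_fractional_matchingD(2)[OF x0[OF a(1)], of w] unfolding rest_def by blast
    let ?M = "M(a := t a)"
    have "bij_betw ?M (A - {a}) (B - {t a})"
      using M(1) by (rule bij_betw_cong[THEN iffD1, rotated]) auto
    then have "bij_betw ?M (insert a (A - {a})) (insert (t a) (B - {t a}))"
      using notIn_Un_bij_betw[of a "A - {a}" ?M "B - {t a}"] by simp
    then have "bij_betw ?M A B"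
      using a(1) t(1)[OF a(1)] by (simp add: insert_absorb)
    moreover have "\<forall>a'\<in>A. 0 < x a' (?M a')"
    proof
      fix a' assume a': "a' \<in> A"
      have "0 < y a a' (?M a')"
        using M(2) a' bij_betw_apply[OF M(1), of a'] by (auto simp: y_def)
      then show "0 < x a' (?M a')"
        using a(1) by (rule x_pos[rotated])
    qed
    moreover have "(\<Sum>a'\<in>A. w a' (?M a')) = w a (t a) + (\<Sum>a'\<in>A - {a}. w a' (M a'))"
      using Suc.prems(1) a(1) by (simp add: sum.remove[of A a])
    ultimately show ?thesis
      using M(3) a(2) by (intro exI[of _ ?M]) auto
  qed
  moreover have "(\<Sum>a\<in>A. \<Sum>b\<in>B. x a b * d a b) \<le> real (card A) * (\<Sum>a\<in>A. d a (N a))"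
    if d: "consistent_on A B R d" and N: "bij_betw N A B" for d N
  proof -
    let ?W = "\<Sum>a\<in>A. d a (N a)"
    have step: "d a (t a) + rest a d \<le> d a (N a) + real m * (?W + d a (N a))" if a: "a \<in> A" for a
    proof -
      have "N a \<in> B"
        using N a by (rule bij_betw_apply)
      then have ta: "d a (t a) \<le> d a (N a)"
        using d a t(1)[OF a] t(2)[OF a, of "N a"] by (auto simp: consistent_on_def)
      obtain N' where N': "bij_betw N' (A - {a}) (B - {t a})"
        "(\<Sum>a'\<in>A - {a}. d a' (N' a')) \<le> ?W + d a (N a)"
        using bij_betw_after_first_pick[OF Suc.prems(1) N a t(1)[OF a] d ta] by blast
      have "consistent_on (A - {a}) (B - {t a}) R d"
        using d by (rule consistent_on_subset) auto
      then have "rest a d \<le> real m * (\<Sum>a'\<in>A - {a}. d a' (N' a'))"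
        using low_distortion_fractional_matchingD(3)[OF x0[OF a] _ N'(1), of d]
          Suc.hyps(2)[symmetric] Suc.prems(1) a
        unfolding rest_def by simp
      also have "\<dots> \<le> real m * (?W + d a (N a))"
        using N'(2) by (intro mult_left_mono) auto
      finally show ?thesis
        using ta by simp
    qed
    have "(\<Sum>a\<in>A. d a (t a) + rest a d) \<le> (\<Sum>a\<in>A. d a (N a) + real m * (?W + d a (N a)))"
      by (intro sum_mono step)
    also have "\<dots> = ?W + real m * (?m * ?W + ?W)"
      using Suc.hyps(2)[symmetric] by (simp add: sum.distrib flip: sum_distrib_left)
    \<comment> \<open>This is the identity 1 + m (m + 2) = (m + 1)^2. The averaging in
      \<open>x_sum\<close> divides by m + 1, which leaves the factor m + 1, the number of
      agents.\<close>
    also have "\<dots> = ?m * (?m * ?W)"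
      by (simp add: algebra_simps)
    finally show ?thesis
      unfolding x_sum Suc.hyps(2)[symmetric] by (simp add: divide_le_eq mult.commute)
  qed
  ultimately show ?case
    using x_nonneg unfolding low_distortion_fractional_matching_def by blast
qed

section \<open>The mechanism\<close>

lemma pseudometric_on_points: "is_metric n d \<Longrightarrow> pseudometric_on (points n) d"
  unfolding is_metric_def pseudometric_on_def .

lemma consistent_on_if_consistent:
  assumes "is_metric n d" "consistent n P d"
  shows "consistent_on {..<n} {..<n} (\<lambda>a. appears_before (P ! a)) (\<lambda>a b. d (Agent a) (Item b))"
proof -
  have "d (Agent a) (Item b) \<le> d (Agent a) (Item b') + d (Agent a') (Item b') + d (Agent a') (Item b)"
    if "a < n" "a' < n" "b < n" "b' < n" for a a' b b'
  proof -
    have p: "Agent a \<in> points n" "Agent a' \<in> points n" "Item b \<in> points n" "Item b' \<in> points n"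
      using that by (auto simp: points_def)
    have "d (Agent a) (Item b) \<le> d (Agent a) (Item b') + d (Item b') (Item b)"
      "d (Item b') (Item b) \<le> d (Item b') (Agent a') + d (Agent a') (Item b)"
      "d (Item b') (Agent a') = d (Agent a') (Item b')"
      using assms(1) p unfolding is_metric_def by blast+
    then show ?thesis
      by linarith
  qed
  then show ?thesis
    using assms unfolding consistent_on_def
    by (auto simp: is_metric_def consistent_def points_def)
qed

text \<open>Provides the favourite remaining item for serial dictatorship: the one at the least
  position in the list.\<close>

lemma first_in_list_exists:
  assumes "B \<subseteq> set xs" "B \<noteq> {}"
  shows "\<exists>t\<in>B. \<forall>b\<in>B. b = t \<or> appears_before xs t b"
proof -
  let ?Q = "\<lambda>p. p < length xs \<and> xs ! p \<in> B"
  define p where "p = (LEAST p. ?Q p)"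
  have index: "\<exists>q<length xs. xs ! q = b" if "b \<in> B" for b
    using that assms(1) in_set_conv_nth[of b xs] by blast
  have "\<exists>p. ?Q p"
    using index assms(2) by blast
  then have "?Q p"
    unfolding p_def by (rule LeastI_ex)
  have "b = xs ! p \<or> appears_before xs (xs ! p) b" if "b \<in> B" for b
  proof -
    obtain q where q: "q < length xs" "xs ! q = b"
      using index[OF \<open>b \<in> B\<close>] by blast
    have "p \<le> q"
      unfolding p_def using q that by (intro Least_le) simp
    then show ?thesis
      using q unfolding appears_before_def by (metis le_neq_implies_less)
  qed
  then show ?thesis
    using \<open>?Q p\<close> by blast
qed

text \<open>\<open>M\<close> is chosen before \<open>d\<close>, hence from the preference lists
  alone, which is what makes it usable as the value of a mechanism. The factor
  \<open>2 * real n\<close> comes from rounding along cuts, the other \<open>real n\<close> from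
  serial dictatorship.\<close>

lemma quadratic_distortion_matching_exists:
  assumes "n \<ge> 1" "is_instance n P"
  shows "\<exists>M. perfect_matching n M \<and>
    (\<forall>d N. is_metric n d \<longrightarrow> consistent n P d \<longrightarrow> perfect_matching n N \<longrightarrow>
      cost n d M \<le> 2 * (real n)\<^sup>2 * cost n d N)"
proof -
  have "\<exists>t\<in>B'. \<forall>b\<in>B'. b = t \<or> appears_before (P ! a) t b"
    if "a \<in> {..<n}" "B' \<subseteq> {..<n}" "B' \<noteq> {}" for a B'
    using that assms(2) by (intro first_in_list_exists) (auto simp: is_instance_def)
  then obtain x where
    x: "low_distortion_fractional_matching {..<n} {..<n} (\<lambda>a. appears_before (P ! a)) x"
    using random_serial_dictatorship[of "{..<n}" "{..<n}" "\<lambda>a. appears_before (P ! a)"] by auto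
  note x_nonneg = low_distortion_fractional_matchingD(1)[OF x]
  \<comment> \<open>With all weight on arcs from agents to items, the cost of \<open>c\<close> under
    a metric is exactly that of the fractional matching \<open>x\<close>.\<close>
  define c where "c p q = (case (p, q) of (Agent a, Item b) \<Rightarrow> x a b | _ \<Rightarrow> 0)" for p q
  have c_nonneg: "0 \<le> c p q" for p q
    using x_nonneg by (auto simp: c_def split: point.split)
  have sum_points: "(\<Sum>p\<in>points n. h p) = (\<Sum>a<n. h (Agent a)) + (\<Sum>b<n. h (Item b))"
    for h :: "point \<Rightarrow> real"
    unfolding points_def by (subst sum.union_disjoint) (auto simp: sum.reindex inj_on_def)
  have c_sum: "(\<Sum>p\<in>points n. \<Sum>q\<in>points n. c p q * h p q) =
      (\<Sum>a<n. \<Sum>b<n. x a b * h (Agent a) (Item b))" for h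
    by (simp add: sum_points c_def)
  have "Agent ` {..<n} \<inter> Item ` {..<n} = {}"
    by auto
  then have points: "finite (points n)" "points n \<noteq> {}" "card (points n) = 2 * n"
    using assms(1) unfolding points_def
    by (auto simp: card_Un_disjoint card_image inj_on_def lessThan_empty_iff)
  obtain w where w: "\<And>p q. 0 \<le> w p q"
    "(\<Sum>p\<in>points n. \<Sum>q\<in>points n. c p q * w p q) \<le> real (card (points n)) - 1"
    "\<And>d p q. pseudometric_on (points n) d \<Longrightarrow> p \<in> points n \<Longrightarrow> q \<in> points n \<Longrightarrow> 0 < c p q \<Longrightarrow>
      d p q \<le> w p q * (\<Sum>p\<in>points n. \<Sum>q\<in>points n. c p q * d p q)"
    using min_cut_decomposition[of _ c, OF points(1,2) c_nonneg] by blast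
  obtain M where M: "bij_betw M {..<n} {..<n}" "\<And>a. a < n \<Longrightarrow> 0 < x a (M a)"
    "(\<Sum>a<n. w (Agent a) (Item (M a))) \<le> (\<Sum>a<n. \<Sum>b<n. x a b * w (Agent a) (Item b))"
    using low_distortion_fractional_matchingD(2)[OF x, of "\<lambda>a b. w (Agent a) (Item b)"] by auto
  have weight: "(\<Sum>a<n. w (Agent a) (Item (M a))) \<le> 2 * real n"
    using M(3) w(2) points(3) unfolding c_sum by simp
  have "cost n d M \<le> 2 * (real n)\<^sup>2 * cost n d N"
    if d: "is_metric n d" "consistent n P d" and N: "perfect_matching n N" for d N
  proof -
    let ?X = "\<Sum>a<n. \<Sum>b<n. x a b * d (Agent a) (Item b)"
    have "0 \<le> ?X"
      using d(1) x_nonneg by (intro sum_nonneg mult_nonneg_nonneg) (auto simp: is_metric_def points_def)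
    \<comment> \<open>\<open>M\<close> uses only pairs in the support of \<open>x\<close>, that is,
      arcs of positive weight, so the bound from the decomposition applies to each of them.\<close>
    have "cost n d M \<le> (\<Sum>a<n. w (Agent a) (Item (M a)) * ?X)"
      unfolding cost_def
    proof (rule sum_mono)
      fix a assume "a \<in> {..<n}"
      moreover from this have "M a < n"
        using M(1) bij_betw_apply by fastforce
      ultimately show "d (Agent a) (Item (M a)) \<le> w (Agent a) (Item (M a)) * ?X"
        using w(3)[OF pseudometric_on_points[OF d(1)], of "Agent a" "Item (M a)"] M(2)[of a]
        unfolding c_sum by (simp add: points_def c_def)
    qed
    also have "\<dots> = (\<Sum>a<n. w (Agent a) (Item (M a))) * ?X"
      by (simp add: sum_distrib_right)
    also have "\<dots> \<le> 2 * real n * ?X"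
      using weight \<open>0 \<le> ?X\<close> by (rule mult_right_mono)
    also have "\<dots> \<le> 2 * real n * (real n * cost n d N)"
      using low_distortion_fractional_matchingD(3)[OF x consistent_on_if_consistent[OF d], of N] N
      by (intro mult_left_mono) (auto simp: cost_def perfect_matching_def)
    finally show ?thesis
      by (simp add: power2_eq_square)
  qed
  then show ?thesis
    using M(1) unfolding perfect_matching_def by blast
qed

theorem mainTheorem1:
  shows "\<exists>(K::real) (f :: preference_lists \<Rightarrow> nat \<Rightarrow> nat).
    K > 0 \<and> matching_mechanism f \<and>
    (\<forall>n\<ge>1. \<forall>P d. is_instance n P \<and> is_metric n d \<and> consistent n P d \<longrightarrow>
       (\<forall>M_opt. min_cost_matching n d M_opt \<longrightarrow>
          cost n d (f P) \<le> K * (real n)\<^sup>2 * cost n d M_opt))"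
proof -
  \<comment> \<open>The mechanism sees only \<open>P\<close>, so n is recovered as
    \<open>length P\<close>. With the premises placed under the existential quantifier the choice is
    total; its value is arbitrary where \<open>P\<close> is not an instance.\<close>
  have "\<forall>P. \<exists>M. length P \<ge> 1 \<longrightarrow> is_instance (length P) P \<longrightarrow>
    perfect_matching (length P) M \<and>
    (\<forall>d N. is_metric (length P) d \<longrightarrow> consistent (length P) P d \<longrightarrow> perfect_matching (length P) N \<longrightarrow>
      cost (length P) d M \<le> 2 * (real (length P))\<^sup>2 * cost (length P) d N)"
    using quadratic_distortion_matching_exists by blast
  then obtain f :: "preference_lists \<Rightarrow> nat \<Rightarrow> nat" where
    f: "\<And>P. length P \<ge> 1 \<Longrightarrow> is_instance (length P) P \<Longrightarrow> perfect_matching (length P) (f P) \<and>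
      (\<forall>d N. is_metric (length P) d \<longrightarrow> consistent (length P) P d \<longrightarrow> perfect_matching (length P) N \<longrightarrow>
        cost (length P) d (f P) \<le> 2 * (real (length P))\<^sup>2 * cost (length P) d N)"
    by metis
  have len: "length P = n" if "is_instance n P" for n P
    using that by (simp add: is_instance_def)
  show ?thesis
  proof (intro exI[of _ 2] exI[of _ f] conjI)
    show "matching_mechanism f"
      using f len unfolding matching_mechanism_def by blast
    show "\<forall>n\<ge>1. \<forall>P d. is_instance n P \<and> is_metric n d \<and> consistent n P d \<longrightarrow>
       (\<forall>M_opt. min_cost_matching n d M_opt \<longrightarrow>
          cost n d (f P) \<le> 2 * (real n)\<^sup>2 * cost n d M_opt)"
      using f len unfolding min_cost_matching_def by blast
  qed simp
qed

end
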